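(* Let $f\colon\mathbb{R}^d\to\mathbb{R}$ be a piecewise affine function such that $S(f)=\{x\in\mathbb{R}^d\mid f(x)\le 0\}$ is nonempty, and let $V\subseteq\mathbb{R}^d$ be a cone. Then for $f$ to have an error bound on $V$ it is sufficient that $f$ is coercive on $V$. Furthermore, this condition becomes necessary (i.e. $f$ is coercive on $V$ whenever $f$ has an error bound on $V$) when $0^+S(f)\cap\operatorname{cl}V=\{0\}$.
   Context: $\mathbb{R}^d$ is equipped with an arbitrary norm $\|\cdot\|$; $\operatorname{dist}(x,Q)=\inf_{y\in Q}\|x-y\|$. A set is polyhedral if it is the intersection of finitely many closed half-spaces. A function $f\colon\mathbb{R}^d\to\mathbb{R}$ is piecewise affine if there are finitely many polyhedral sets $Q_1,\ldots,Q_s$ with nonempty, pairwise disjoint interiors covering $\mathbb{R}^d$ and affine functions $F_1,\ldots,F_s$ such that $f=F_k$ on $Q_k$ for each $k$. Equivalently (a known theorem of Gorokhovik and Zorko), $f(x)=\min_{i\in I}\max_{j\in J(i)}(a_{ij}+\langle v_{ij},x\rangle)$ for some finite index sets $I$, $J(i)$ and some $a_{ij}\in\mathbb{R}$, $v_{ij}\in\mathbb{R}^d$. The function $f$ has an error bound on $V$ if there exists $\tau>0$ such that $\tau\operatorname{dist}(x,S(f))\le\max\{f(x),0\}$ for all $x\in V$. The function $f$ is coercive on $V$ if $f(x_n)\to+\infty$ for any sequence $\{x_n\}\subset V$ such that $\|x_n\|\to+\infty$ as $n\to\infty$. A cone is a nonempty set $K$ (not necessarily convex or closed) with $tx\in K$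 for all $x\in K$, $t\ge 0$; $\operatorname{cl}$ denotes closure. The recession cone $0^+Q$ of a nonempty set $Q\subseteq\mathbb{R}^d$ is the set of all $z\in\mathbb{R}^d$ for which there exists $x\in Q$ such that $x+\lambda z\in Q$ for all $\lambda\ge 0$. *)

theory Defs
  imports "HOL-Analysis.Analysis"
begin

text \<open>
  The arbitrary norm on \<open>\<real>\<^sup>d\<close> is a function \<open>N\<close>, since the type-class \<open>norm\<close> on
  \<^typ>\<open>real ^ 'd\<close> is the Euclidean one. Topological notions (interior, closure) are the
  library ones: all norms on a finite-dimensional space induce the same topology.
  Nonnegativity of \<open>N\<close> follows from the three axioms.
\<close>

definition is_norm :: "('a::real_vector \<Rightarrow> real) \<Rightarrow> bool" where
  "is_norm N \<longleftrightarrow>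
     (\<forall>x. N x = 0 \<longleftrightarrow> x = 0) \<and>
     (\<forall>c x. N (c *\<^sub>R x) = \<bar>c\<bar> * N x) \<and>
     (\<forall>x y. N (x + y) \<le> N x + N y)"

text \<open>Meaningful for nonempty \<open>Q\<close> only (the infimum of the empty set is unspecified).\<close>

definition norm_dist :: "('a::real_vector \<Rightarrow> real) \<Rightarrow> 'a \<Rightarrow> 'a set \<Rightarrow> real" where
  "norm_dist N x Q = (INF y\<in>Q. N (x - y))"

definition affine_fun :: "('a::euclidean_space \<Rightarrow> real) \<Rightarrow> bool" where
  "affine_fun F \<longleftrightarrow> (\<exists>a v. \<forall>x. F x = a + v \<bullet> x)"

text \<open>
  The sets \<open>Q k\<close> themselves cover the space; their interiors are nonempty and pairwise disjoint.
\<close>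

definition piecewise_affine :: "('a::euclidean_space \<Rightarrow> real) \<Rightarrow> bool" where
  "piecewise_affine f \<longleftrightarrow>
     (\<exists>(s::nat) (Q :: nat \<Rightarrow> 'a set) (F :: nat \<Rightarrow> 'a \<Rightarrow> real).
        (\<forall>k\<in>{1..s}. polyhedron (Q k) \<and> interior (Q k) \<noteq> {}) \<and>
        (\<forall>k\<in>{1..s}. \<forall>l\<in>{1..s}. k \<noteq> l \<longrightarrow> interior (Q k) \<inter> interior (Q l) = {}) \<and>
        (\<Union>k\<in>{1..s}. Q k) = UNIV \<and>
        (\<forall>k\<in>{1..s}. affine_fun (F k) \<and> (\<forall>x\<in>Q k. f x = F k x)))"

definition sublevel :: "('a \<Rightarrow> real) \<Rightarrow> 'a set" where
  "sublevel f = {x. f x \<le> 0}"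

definition has_error_bound_on ::
  "('a::real_vector \<Rightarrow> real) \<Rightarrow> ('a \<Rightarrow> real) \<Rightarrow> 'a set \<Rightarrow> bool" where
  "has_error_bound_on N f V \<longleftrightarrow>
     (\<exists>\<tau>>0. \<forall>x\<in>V. \<tau> * norm_dist N x (sublevel f) \<le> max (f x) 0)"

definition coercive_on ::
  "('a::real_vector \<Rightarrow> real) \<Rightarrow> ('a \<Rightarrow> real) \<Rightarrow> 'a set \<Rightarrow> bool" where
  "coercive_on N f V \<longleftrightarrow>
     (\<forall>x :: nat \<Rightarrow> 'a. (\<forall>n. x n \<in> V) \<longrightarrow>
        filterlim (\<lambda>n. N (x n)) at_top sequentially \<longrightarrow>
        filterlim (\<lambda>n. f (x n)) at_top sequentially)"

text \<open>The base point \<open>x\<close> may depend on \<open>z\<close>; \<open>Q\<close> need not be convex.\<close>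

definition recession_cone :: "'a::real_vector set \<Rightarrow> 'a set" where
  "recession_cone Q = {z. \<exists>x\<in>Q. \<forall>c\<ge>0. x + c *\<^sub>R z \<in> Q}"

end

theory Submission
  imports Defs
begin

text \<open>
  On a cell meeting a bounded region, \<open>f\<close> is affine on a polytope, where an error bound holds by
  splitting the vertices according to the sign of the affine function; so \<open>f\<close> always has an error
  bound on bounded sets. Moreover \<open>s \<mapsto> s f (x / s)\<close> is Lipschitz on \<open>[1, \<infinity>)\<close> with a constant
  independent of \<open>x\<close>: where \<open>x / s\<close> lies in a cell with \<open>f y = a + v \<bullet> y\<close>, it equals \<open>a s + v \<bullet> x\<close>.
  On a cone, coercivity therefore upgrades to linear growth, which gives the error bound far away.
  Conversely, if \<open>f\<close> stays bounded along \<open>x n \<in> V\<close> with \<open>x n \<rightarrow> \<infinity>\<close>, the error bound yields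
  points of the sublevel set at bounded distance from \<open>x n\<close>; infinitely many of them lie in one
  convex piece, and a limit of the directions of \<open>x n\<close> is a common direction of recession.
\<close>

section \<open>Comparison of \<open>N\<close> with the Euclidean norm, and the distance it
  induces\<close>

lemma is_norm_ge_0:
  assumes "is_norm N"
  shows "N x \<ge> 0"
proof -
  have "N (x + (-1) *\<^sub>R x) \<le> N x + N ((-1) *\<^sub>R x)" "N ((-1) *\<^sub>R x) = \<bar>-1\<bar> * N x" "N 0 = 0"
    using assms unfolding is_norm_def by blast+
  then show ?thesis by simp
qed

text \<open>A finite convex function on the whole space is continuous, so \<open>N\<close> attains a
  minimum and a maximum on the Euclidean unit sphere; homogeneity carries these bounds to all
  vectors.\<close>

lemma is_norm_equivalent:
  fixes N :: "'a::euclidean_space \<Rightarrow> real"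
  assumes N: "is_norm N"
  obtains b B where "b > 0" "B > 0" "\<And>x. b * norm x \<le> N x" "\<And>x. N x \<le> B * norm x"
proof -
  have sc: "N (c *\<^sub>R x) = \<bar>c\<bar> * N x" and tri: "N (x + y) \<le> N x + N y" and z: "N x = 0 \<longleftrightarrow> x = 0"
    for c x y using N unfolding is_norm_def by blast+
  have "convex_on UNIV N"
    unfolding convex_on_def using tri by (metis UNIV_I abs_of_nonneg convex_UNIV sc)
  then have cont: "continuous_on (sphere 0 1) N"
    using convex_on_continuous[OF open_UNIV] continuous_on_subset by blast
  have ne: "sphere (0::'a) 1 \<noteq> {}" by simp
  obtain p where p: "p \<in> sphere 0 1" "\<And>y. y \<in> sphere 0 1 \<Longrightarrow> N p \<le> N y"
    using continuous_attains_inf[OF compact_sphere ne cont] by blast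
  obtain q where q: "q \<in> sphere 0 1" "\<And>y. y \<in> sphere 0 1 \<Longrightarrow> N y \<le> N q"
    using continuous_attains_sup[OF compact_sphere ne cont] by blast
  have "p \<noteq> 0" using p(1) by auto
  then have pos: "N p > 0" using z is_norm_ge_0[OF N, of p] by (simp add: less_le)
  then have pos': "N q > 0" using p(1) q(2) less_le_trans by blast
  have both: "N p * norm x \<le> N x \<and> N x \<le> N q * norm x" for x
  proof (cases "x = 0")
    case False
    then have u: "inverse (norm x) *\<^sub>R x \<in> sphere 0 1" by simp
    have "N (x /\<^sub>R norm x) = N x / norm x" by (simp add: sc divide_inverse mult.commute)
    then show ?thesis using p(2)[OF u] q(2)[OF u] False
      by (simp add: pos_le_divide_eq pos_divide_le_eq del: norm_inverse)
  qed (use z[of 0] in simp)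
  then show ?thesis using that pos pos' by blast
qed

lemma norm_dist_le:
  assumes "is_norm N" "y \<in> Q"
  shows "norm_dist N x Q \<le> N (x - y)"
  unfolding norm_dist_def
proof (rule cINF_lower[OF _ assms(2)])
  show "bdd_below ((\<lambda>y. N (x - y)) ` Q)"
    using is_norm_ge_0[OF assms(1)] by (intro bdd_belowI2)
qed

lemma norm_dist_less_obtains:
  assumes "is_norm N" "Q \<noteq> {}" "norm_dist N x Q < r"
  obtains y where "y \<in> Q" "N (x - y) < r"
proof -
  have "bdd_below ((\<lambda>y. N (x - y)) ` Q)"
    using is_norm_ge_0[OF assms(1)] by (intro bdd_belowI2)
  then show ?thesis
    using assms(3) that unfolding norm_dist_def cINF_less_iff[OF assms(2) \<open>bdd_below _\<close>] by blast
qed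

section \<open>Error bounds on polytopes and on bounded sets\<close>

text \<open>If the affine function is positive at every generator of \<open>P\<close>, it is bounded
  away from 0 on \<open>P\<close>: the first alternative. Otherwise a point with positive value
  slides towards the hull of the nonpositive generators until the value is 0, at a rate of descent
  bounded below uniformly.\<close>

lemma polytope_error_bound:
  fixes P :: "'a::euclidean_space set"
  assumes "polytope P"
  obtains \<tau> where "\<tau> > 0"
    "\<And>x. x \<in> P \<Longrightarrow> \<tau> \<le> a + v \<bullet> x \<or>
       (\<exists>y\<in>P. a + v \<bullet> y \<le> 0 \<and> \<tau> * norm (x - y) \<le> max (a + v \<bullet> x) 0)"
proof -
  obtain W where W: "finite W" "P = convex hull W"
    using assms unfolding polytope_def by blast
  define F where "F x = a + v \<bullet> x" for x
  define V0 where "V0 = {w\<in>W. F w \<le> 0}"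
  define V1 where "V1 = {w\<in>W. F w > 0}"
  have W01: "W = V0 \<union> V1" unfolding V0_def V1_def by auto
  have V0: "F x \<le> 0" if "x \<in> convex hull V0" for x
  proof -
    have "{x. F x \<le> 0} = {x. v \<bullet> x \<le> - a}" by (auto simp: F_def)
    then have "convex {x. F x \<le> 0}" using convex_halfspace_le by simp
    then have "convex hull V0 \<subseteq> {x. F x \<le> 0}"
      by (intro hull_minimal) (auto simp: V0_def)
    then show ?thesis using that by blast
  qed
  obtain m where m: "m > 0" "\<And>x. x \<in> convex hull V1 \<Longrightarrow> m \<le> F x"
  proof -
    \<comment> \<open>\<open>insert 1\<close> keeps \<open>Min\<close> defined when
      \<open>V1\<close> is empty, where any positive bound serves.\<close>
    define m where "m = Min (insert 1 (F ` V1))"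
    have fin: "finite (insert 1 (F ` V1))" using W(1) by (simp add: V1_def)
    have "m > 0" using fin by (auto simp: m_def V1_def)
    moreover have "{x. m \<le> F x} = {x. v \<bullet> x \<ge> m - a}" by (auto simp: F_def)
    then have "convex {x. m \<le> F x}" using convex_halfspace_ge by simp
    then have "convex hull V1 \<subseteq> {x. m \<le> F x}"
      by (intro hull_minimal) (use fin in \<open>auto simp: m_def\<close>)
    ultimately show ?thesis using that by blast
  qed
  obtain D where D: "D > 0" "\<And>x y. x \<in> P \<Longrightarrow> y \<in> P \<Longrightarrow> norm (x - y) \<le> D"
  proof -
    have "bounded P" using assms polytope_imp_bounded by blast
    then obtain B where B: "\<And>x. x \<in> P \<Longrightarrow> norm x \<le> B" unfolding bounded_iff by blast
    show ?thesis
    proof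
      show "2 * \<bar>B\<bar> + 1 > 0" by simp
      show "norm (x - y) \<le> 2 * \<bar>B\<bar> + 1" if "x \<in> P" "y \<in> P" for x y
        using B[OF that(1)] B[OF that(2)] norm_triangle_ineq4[of x y] by linarith
    qed
  qed
  have main: "\<exists>y\<in>P. F y \<le> 0 \<and> m / D * norm (x - y) \<le> max (F x) 0"
    if x: "x \<in> P" "V0 \<noteq> {}" for x
  proof (cases "F x \<le> 0 \<or> V1 = {}")
    case True
    then have "F x \<le> 0" using x W W01 V0 by auto
    then show ?thesis using x by (intro bexI[of _ x]) auto
  next
    case False
    then have Fx: "F x > 0" and "V1 \<noteq> {}" by auto
    have "convex hull V0 \<noteq> {}" "convex hull V1 \<noteq> {}" using x(2) \<open>V1 \<noteq> {}\<close> by auto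
    moreover have "x \<in> convex hull (convex hull V0 \<union> convex hull V1)"
      using x(1) unfolding W(2) W01 by (meson Un_mono hull_mono hull_subset subsetD)
    ultimately obtain s w p q where eq: "x = s *\<^sub>R p + w *\<^sub>R q" and sw: "s \<ge> 0" "w \<ge> 0" "s + w = 1"
      and p: "p \<in> convex hull V0" and q: "q \<in> convex hull V1"
      using convex_hull_union_two[OF convex_convex_hull _ convex_convex_hull] by blast
    have pP: "p \<in> P" and qP: "q \<in> P"
      using p q W W01 hull_mono[of V0 W] hull_mono[of V1 W] by blast+
    have Fp: "F p \<le> 0" and Fq: "m \<le> F q" using V0[OF p] m(2)[OF q] .
    have s: "s = 1 - w" using sw by simp
    have Fxw: "F x - F p = w * (F q - F p)"
      unfolding F_def eq s by (simp add: algebra_simps)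
    define d where "d = F q - F p"
    have d: "d \<ge> m" "d > 0" using Fp Fq m(1) by (auto simp: d_def)
    have "w * d > 0" using Fxw Fx Fp d_def by simp
    then have w: "w > 0" using d(2) by (simp add: zero_less_mult_iff)
    \<comment> \<open>Along \<open>p - q\<close> the function \<open>F\<close> falls at rate
      \<open>d\<close>, so the multiple \<open>F x / d\<close> brings it from \<open>F x\<close>
      down to 0.\<close>
    define y where "y = x + (F x / d) *\<^sub>R (p - q)"
    have Fy: "F y = 0"
    proof -
      have "F y = F x + (F x / d) * (F p - F q)"
        unfolding y_def F_def by (simp add: inner_add_right inner_diff_right)
      also have "F p - F q = - d" by (simp add: d_def)
      finally show ?thesis using d by simp
    qed
    have yP: "y \<in> P"
    proof -
      \<comment> \<open>Since \<open>x - p = w *\<^sub>R (q - p)\<close>, the point \<open>y\<close>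
        lies on the segment from \<open>x\<close> to \<open>p\<close>: its parameter is
        \<open>F x / (F x - F p)\<close>, at most 1 because \<open>F p \<le> 0\<close>.\<close>
      define t where "t = F x / (w * d)"
      have t: "0 \<le> t" "t \<le> 1" using Fx \<open>w * d > 0\<close> Fxw Fp by (auto simp: t_def d_def)
      have "F x / d = t * w" using w by (simp add: t_def)
      then have "y = (1 - t) *\<^sub>R x + t *\<^sub>R p"
        unfolding y_def eq s by (simp add: algebra_simps)
      moreover have "convex P" using W by simp
      ultimately show ?thesis using convexD_alt[of P x p t] x(1) pP t by simp
    qed
    have "norm (x - y) = F x / d * norm (p - q)"
      using Fx d(2) by (simp add: y_def)
    also have "\<dots> \<le> F x / m * D"
      using Fx d m(1) D(2)[OF pP qP] by (intro mult_mono divide_left_mono) auto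
    finally have "m / D * norm (x - y) \<le> F x"
      using m(1) D(1) by (simp add: field_simps)
    then show ?thesis using yP Fy by (intro bexI[of _ y]) auto
  qed
  show ?thesis
  proof (cases "V0 = {}")
    case True
    then show ?thesis using that[of m] m W W01 F_def by auto
  next
    case False
    then show ?thesis using that[of "m / D"] main m(1) D(1) F_def by auto
  qed
qed

lemma piecewise_affine_obtains:
  fixes f :: "'a::euclidean_space \<Rightarrow> real"
  assumes "piecewise_affine f"
  obtains I :: "nat set" and Q a v
  where "finite I" "\<And>k. k \<in> I \<Longrightarrow> polyhedron (Q k)" "\<And>x. \<exists>k\<in>I. x \<in> Q k"
    "\<And>k x. k \<in> I \<Longrightarrow> x \<in> Q k \<Longrightarrow> f x = a k + v k \<bullet> x"
proof -
  obtain s :: nat and Q F where *: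
    "\<forall>k\<in>{1..s}. polyhedron (Q k) \<and> interior (Q k) \<noteq> {}" "(\<Union>k\<in>{1..s}. Q k) = UNIV"
    "\<forall>k\<in>{1..s}. affine_fun (F k) \<and> (\<forall>x\<in>Q k. f x = F k x)"
    using assms unfolding piecewise_affine_def by (elim exE conjE) (rule that; assumption)
  then have "\<forall>k\<in>{1..s}. \<exists>a v. \<forall>x\<in>Q k. f x = a + v \<bullet> x"
    unfolding affine_fun_def by metis
  then obtain a v where "\<forall>k\<in>{1..s}. \<forall>x\<in>Q k. f x = a k + v k \<bullet> x" by metis
  then show ?thesis using * by (intro that[of "{1..s}" Q a v]) auto
qed

text \<open>A box around the ball turns each cell into a polytope, giving finitely many constants.
  Where only a positive lower bound on \<open>f x\<close> is available, a fixed point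
  \<open>y0\<close> of the sublevel set serves, being at bounded distance.\<close>

lemma piecewise_affine_bounded_error_bound:
  fixes f :: "'a::euclidean_space \<Rightarrow> real"
  assumes "piecewise_affine f" "sublevel f \<noteq> {}"
  obtains \<tau> where "\<tau> > 0"
    "\<And>x. norm x \<le> R \<Longrightarrow> \<exists>y\<in>sublevel f. \<tau> * norm (x - y) \<le> max (f x) 0"
proof -
  obtain I :: "nat set" and Q a v where I: "finite I" "\<And>k. k \<in> I \<Longrightarrow> polyhedron (Q k)"
    and cov: "\<And>x. \<exists>k\<in>I. x \<in> Q k"
    and f: "\<And>k x. k \<in> I \<Longrightarrow> x \<in> Q k \<Longrightarrow> f x = a k + v k \<bullet> x"
    using assms(1) by (rule piecewise_affine_obtains) blast
  obtain y0 where y0: "y0 \<in> sublevel f" using assms(2) by blast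
  obtain c :: 'a where c: "cball 0 R \<subseteq> cbox (-c) c"
    using bounded_subset_cbox_symmetric bounded_cball by blast
  define P where "P k = cbox (-c) c \<inter> Q k" for k
  have "\<exists>\<tau>>0. \<forall>x\<in>P k. \<tau> \<le> a k + v k \<bullet> x \<or>
       (\<exists>y\<in>P k. a k + v k \<bullet> y \<le> 0 \<and> \<tau> * norm (x - y) \<le> max (a k + v k \<bullet> x) 0)"
    if "k \<in> I" for k
  proof -
    have "polytope (P k)"
      unfolding P_def using polytope_Int_polyhedron polytope_interval I(2) that by blast
    then show ?thesis using polytope_error_bound[of "P k" "a k" "v k"] by metis
  qed
  then obtain t where t0: "\<And>k. k \<in> I \<Longrightarrow> t k > 0"
    "\<And>k x. k \<in> I \<Longrightarrow> x \<in> P k \<Longrightarrow> t k \<le> a k + v k \<bullet> x \<or>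
       (\<exists>y\<in>P k. a k + v k \<bullet> y \<le> 0 \<and> t k * norm (x - y) \<le> max (a k + v k \<bullet> x) 0)"
    by metis
  have t: "t k \<le> f x \<or> (\<exists>y\<in>sublevel f. t k * norm (x - y) \<le> max (f x) 0)"
    if "k \<in> I" "x \<in> P k" for k x
    using t0(2)[OF that] f[OF that(1)] that(2) by (auto simp: P_def sublevel_def)
  define D where "D = \<bar>R\<bar> + norm y0 + 1"
  have D: "D \<ge> 1" by (simp add: D_def)
  \<comment> \<open>Division by \<open>D\<close> handles the case where \<open>y0\<close> is used,
    at distance at most \<open>D\<close>; \<open>D \<ge> 1\<close> keeps the quotient below every
    \<open>t k\<close>.\<close>
  define \<tau> where "\<tau> = Min (insert 1 (t ` I)) / D"
  have m: "Min (insert 1 (t ` I)) > 0" using I(1) t0(1) by auto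
  show ?thesis
  proof
    show "\<tau> > 0" using m D by (simp add: \<tau>_def)
    fix x :: 'a assume x: "norm x \<le> R"
    obtain k where k: "k \<in> I" "x \<in> Q k" using cov by blast
    have "x \<in> cball 0 R" using x by simp
    then have "x \<in> P k" using c k by (auto simp: P_def)
    have le: "Min (insert 1 (t ` I)) \<le> t k" using I(1) k(1) by simp
    then have "\<tau> \<le> t k / 1"
      unfolding \<tau>_def using m D by (intro frac_le) auto
    from t[OF k(1) \<open>x \<in> P k\<close>] show "\<exists>y\<in>sublevel f. \<tau> * norm (x - y) \<le> max (f x) 0"
    proof
      assume tf: "t k \<le> f x"
      have "norm (x - y0) \<le> D"
        using norm_triangle_ineq4[of x y0] x by (simp add: D_def)
      then have "\<tau> * norm (x - y0) \<le> \<tau> * D"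
        using \<open>\<tau> > 0\<close> by simp
      also have "\<dots> = Min (insert 1 (t ` I))" using D by (simp add: \<tau>_def)
      finally show ?thesis using y0 le tf by (intro bexI[of _ y0]) auto
    next
      assume "\<exists>y\<in>sublevel f. t k * norm (x - y) \<le> max (f x) 0"
      then obtain y where y: "y \<in> sublevel f" "t k * norm (x - y) \<le> max (f x) 0" by blast
      have "\<tau> * norm (x - y) \<le> t k * norm (x - y)"
        using \<open>\<tau> \<le> t k / 1\<close> by (simp add: mult_right_mono)
      then show ?thesis using y by (intro bexI[of _ y]) auto
    qed
  qed
qed

section \<open>From coercivity to an error bound on a cone\<close>

lemma piecewise_affine_almost_homogeneous:
  fixes f :: "'a::euclidean_space \<Rightarrow> real"
  assumes "piecewise_affine f"
  obtains A where "A \<ge> 0" "\<And>x s. s \<ge> 1 \<Longrightarrow> \<bar>f (x /\<^sub>R s) - f x / s\<bar> \<le> A"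
proof -
  obtain I :: "nat set" and Q a v where I: "finite I" "\<And>k. k \<in> I \<Longrightarrow> polyhedron (Q k)"
    and cov: "\<And>x. \<exists>k\<in>I. x \<in> Q k"
    and f: "\<And>k x. k \<in> I \<Longrightarrow> x \<in> Q k \<Longrightarrow> f x = a k + v k \<bullet> x"
    using assms(1) by (rule piecewise_affine_obtains) blast
  define A where "A = (\<Sum>k\<in>I. \<bar>a k\<bar>)"
  have aA: "\<bar>a k\<bar> \<le> A" if "k \<in> I" for k
    unfolding A_def by (rule member_le_sum) (use that I in auto)
  have A: "A \<ge> 0" unfolding A_def by (simp add: sum_nonneg)
  have "\<bar>f (x /\<^sub>R s) - f x / s\<bar> \<le> A" if s: "s \<ge> 1" for x s
  proof -
    define g where "g r = r * f (x /\<^sub>R r)" for r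
    define U where "U k = {r \<in> {1..s}. x /\<^sub>R r \<in> Q k}" for k
    \<comment> \<open>The factor \<open>r\<close> cancels the scaling in the linear part, so
      \<open>g\<close> has slope \<open>a k\<close> on \<open>U k\<close>.\<close>
    have g: "g r = a k * r + v k \<bullet> x" if "k \<in> I" "r \<in> U k" for k r
      using that f[of k "x /\<^sub>R r"] by (auto simp: g_def U_def field_simps)
    have "A-lipschitz_on {1..s} g"
    \<comment> \<open>Finitely many closed pieces \<open>U k\<close> cover an interval, so a
      Lipschitz constant common to the pieces holds on all of it, however often the ray changes
      cells.\<close>
    proof (rule lipschitz_on_closed_Union)
      fix k assume k: "k \<in> I"
      show "A-lipschitz_on (U k) g"
      proof (rule lipschitz_onI)
        fix r t assume "r \<in> U k" "t \<in> U k"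
        then have "dist (g r) (g t) = \<bar>a k\<bar> * dist r t"
          using g k by (simp add: dist_real_def abs_mult flip: right_diff_distrib)
        then show "dist (g r) (g t) \<le> A * dist r t"
          using aA[OF k] by (simp add: mult_right_mono)
      qed (rule A)
      have "continuous_on {1..s} (\<lambda>r. x /\<^sub>R r)" by (intro continuous_intros) auto
      then have "closed ({1..s} \<inter> (\<lambda>r. x /\<^sub>R r) -` Q k)"
        by (intro continuous_closed_preimage closed_atLeastAtMost polyhedron_imp_closed I(2) k)
      moreover have "U k = {1..s} \<inter> (\<lambda>r. x /\<^sub>R r) -` Q k" by (auto simp: U_def)
      ultimately show "closed (U k)" by simp
    next
      show "{1..s} \<subseteq> (\<Union>k\<in>I. U k)" using cov unfolding U_def by fastforce
    qed (use I A in auto)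
    then have "dist (g s) (g 1) \<le> A * dist s 1"
      using s by (intro lipschitz_onD) auto
    \<comment> \<open>\<open>A * (s - 1)\<close> is relaxed to \<open>A * s\<close>, so that
      division by \<open>s\<close> leaves \<open>A\<close>.\<close>
    then have "\<bar>s * f (x /\<^sub>R s) - f x\<bar> \<le> A * s"
      using s A by (simp add: g_def dist_real_def algebra_simps)
    moreover have "f (x /\<^sub>R s) - f x / s = (s * f (x /\<^sub>R s) - f x) / s"
      using s by (simp add: field_simps)
    ultimately show ?thesis using s by (simp add: pos_divide_le_eq)
  qed
  then show ?thesis using that A by blast
qed

text \<open>Turns the sequential definition into a uniform threshold: without one, points of
  \<open>N\<close>-value at least \<open>n + 1\<close> and \<open>f\<close>-value below
  \<open>C\<close> would form a sequence violating coercivity.\<close>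

lemma coercive_onD:
  assumes "coercive_on N f V"
  obtains R where "R > 0" "\<And>x. x \<in> V \<Longrightarrow> R \<le> N x \<Longrightarrow> C \<le> f x"
proof (rule ccontr)
  assume "\<not> thesis"
  then have "\<exists>x. x \<in> V \<and> real n + 1 \<le> N x \<and> f x < C" for n :: nat
    using that[of "real n + 1"] by force
  then obtain x where x: "\<And>n. x n \<in> V" "\<And>n. real n + 1 \<le> N (x n)" "\<And>n. f (x n) < C"
    by metis
  have "filterlim (\<lambda>n. N (x n)) at_top sequentially"
    by (rule filterlim_at_top_mono[OF filterlim_real_sequentially])
      (intro always_eventually allI order_trans[OF _ x(2)], simp)
  then have "filterlim (\<lambda>n. f (x n)) at_top sequentially"
    using assms x(1) unfolding coercive_on_def by blast
  then have "eventually (\<lambda>n. C \<le> f (x n)) sequentially"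
    by (simp add: filterlim_at_top)
  then show False using x(3) by (auto simp: eventually_sequentially not_le[symmetric])
qed

text \<open>A far point is scaled back to \<open>N\<close>-norm \<open>R\<close>, staying in the
  cone, where \<open>f\<close> is at least \<open>A + 1\<close>. Undoing the scaling costs at most
  \<open>A\<close>, so \<open>f x / s\<close> is still at least 1.\<close>

lemma coercive_imp_linear_growth:
  fixes f :: "'a::euclidean_space \<Rightarrow> real"
  assumes N: "is_norm N" and f: "piecewise_affine f" and V: "cone V" and co: "coercive_on N f V"
  obtains R where "R > 0" "\<And>x. x \<in> V \<Longrightarrow> R \<le> N x \<Longrightarrow> N x / R \<le> f x"
proof -
  obtain A where A: "A \<ge> 0" "\<And>x s. s \<ge> 1 \<Longrightarrow> \<bar>f (x /\<^sub>R s) - f x / s\<bar> \<le> A"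
    by (rule piecewise_affine_almost_homogeneous[OF f]) blast
  obtain R where R: "R > 0" "\<And>x. x \<in> V \<Longrightarrow> R \<le> N x \<Longrightarrow> A + 1 \<le> f x"
    by (rule coercive_onD[OF co]) blast
  have "N x / R \<le> f x" if x: "x \<in> V" "R \<le> N x" for x
  proof -
    define s where "s = N x / R"
    have s: "s \<ge> 1" using x R(1) by (simp add: s_def)
    have "x /\<^sub>R s \<in> V" using V x(1) s by (simp add: cone_def)
    moreover have "N (x /\<^sub>R s) = N x / s"
      using N s unfolding is_norm_def by (simp add: divide_inverse mult.commute)
    then have "N (x /\<^sub>R s) = R" using s R(1) by (auto simp: s_def)
    ultimately have "A + 1 \<le> f (x /\<^sub>R s)" using R(2) by simp
    then have "1 \<le> f x / s" using A(2)[OF s, of x] by linarith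
    then show ?thesis using s by (simp add: field_simps flip: s_def)
  qed
  then show ?thesis using that R(1) by blast
qed

lemma coercive_imp_error_bound:
  fixes f :: "'a::euclidean_space \<Rightarrow> real"
  assumes N: "is_norm N" and f: "piecewise_affine f" and ne: "sublevel f \<noteq> {}"
    and V: "cone V" and co: "coercive_on N f V"
  shows "has_error_bound_on N f V"
proof -
  obtain b B where bB: "b > 0" "B > 0" "\<And>x. b * norm x \<le> N x" "\<And>x. N x \<le> B * norm x"
    by (rule is_norm_equivalent[OF N]) blast
  obtain R where R: "R > 0" "\<And>x. x \<in> V \<Longrightarrow> R \<le> N x \<Longrightarrow> N x / R \<le> f x"
    by (rule coercive_imp_linear_growth[OF N f V co]) blast
  \<comment> \<open>The radius is \<open>R / b\<close> because the Euclidean ball of that radius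
    contains the \<open>N\<close>-ball of radius \<open>R\<close>.\<close>
  obtain \<tau> where \<tau>: "\<tau> > 0"
    "\<And>x. norm x \<le> R / b \<Longrightarrow> \<exists>y\<in>sublevel f. \<tau> * norm (x - y) \<le> max (f x) 0"
    by (rule piecewise_affine_bounded_error_bound[OF f ne]) blast
  obtain y0 where y0: "y0 \<in> sublevel f" using ne by blast
  \<comment> \<open>Chosen so that \<open>N (x - y0) \<le> M * (N x / R)\<close> once
    \<open>R \<le> N x\<close>: the constant \<open>N (- y0)\<close> is absorbed because
    \<open>N x / R\<close> is then at least 1.\<close>
  define M where "M = R + N (- y0)"
  have M: "M > 0" using R(1) is_norm_ge_0[OF N, of "- y0"] by (simp add: M_def)
  \<comment> \<open>The first entry serves the points with \<open>N x < R\<close>, with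
    \<open>B\<close> converting the Euclidean bound to \<open>N\<close>; the second serves the far
    points.\<close>
  define \<sigma> where "\<sigma> = min (\<tau> / B) (1 / M)"
  have \<sigma>: "\<sigma> > 0" "\<sigma> \<le> \<tau> / B" "\<sigma> \<le> 1 / M" using \<tau>(1) bB(2) M by (auto simp: \<sigma>_def)
  have "\<sigma> * norm_dist N x (sublevel f) \<le> max (f x) 0" if x: "x \<in> V" for x
  proof (cases "R \<le> N x")
    case True
    have "N (x - y0) \<le> N x + N (- y0)"
      using N unfolding is_norm_def by (metis diff_conv_add_uminus)
    also have "\<dots> \<le> N x + N (- y0) * (N x / R)"
      using True R(1) is_norm_ge_0[OF N, of "- y0"]
      by (simp add: mult_left_le pos_le_divide_eq mult_left_mono)
    also have "\<dots> = M * (N x / R)" using R(1) by (simp add: M_def field_simps)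
    finally have "norm_dist N x (sublevel f) \<le> M * (N x / R)"
      using norm_dist_le[OF N y0, of x] by linarith
    then have "\<sigma> * norm_dist N x (sublevel f) \<le> \<sigma> * (M * (N x / R))"
      using \<sigma>(1) by (intro mult_left_mono) auto
    also have "\<dots> \<le> (1 / M) * (M * (N x / R))"
      using \<sigma>(3) M R(1) is_norm_ge_0[OF N, of x] by (intro mult_right_mono) auto
    also have "\<dots> \<le> f x" using M R(2)[OF x True] by simp
    finally show ?thesis by simp
  next
    case False
    then have "norm x \<le> R / b" using bB(1) bB(3)[of x] by (simp add: field_simps)
    then obtain y where y: "y \<in> sublevel f" "\<tau> * norm (x - y) \<le> max (f x) 0" using \<tau>(2) by blast
    have "norm_dist N x (sublevel f) \<le> B * norm (x - y)"
      using norm_dist_le[OF N y(1)] bB(4) order_trans by blast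
    then have "\<sigma> * norm_dist N x (sublevel f) \<le> \<sigma> * (B * norm (x - y))"
      using \<sigma>(1) by simp
    also have "\<dots> \<le> \<tau> / B * (B * norm (x - y))"
      using \<sigma>(2) bB(2) by (intro mult_right_mono) auto
    also have "\<dots> = \<tau> * norm (x - y)" using bB(2) by simp
    finally show ?thesis using y(2) by simp
  qed
  then show ?thesis using \<sigma>(1) unfolding has_error_bound_on_def by blast
qed

section \<open>Recession directions and the necessity of coercivity\<close>

text \<open>The segment from \<open>p\<close> to \<open>w n\<close> lies in \<open>P\<close>; its
  point at fraction \<open>c / t n\<close> tends to \<open>p + c *\<^sub>R z\<close>, and closedness
  keeps the limit in \<open>P\<close>.\<close>

lemma closed_convex_recession_limit:
  fixes P :: "'a::real_normed_vector set"
  assumes "closed P" "convex P" "p \<in> P" "c \<ge> 0" "\<And>n. w n \<in> P"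
    and t: "filterlim t at_top sequentially" and lim: "(\<lambda>n. w n /\<^sub>R t n) \<longlonglongrightarrow> z"
  shows "p + c *\<^sub>R z \<in> P"
proof (rule Lim_in_closed_set[OF \<open>closed P\<close>])
  define y where "y n = (1 - c / t n) *\<^sub>R p + (c / t n) *\<^sub>R w n" for n
  show "eventually (\<lambda>n. y n \<in> P) sequentially"
    \<comment> \<open>The threshold \<open>c + 1\<close> makes \<open>t n\<close> positive and
      \<open>c / t n\<close> at most 1.\<close>
    using t[unfolded filterlim_at_top, rule_format, of "c + 1"]
  proof eventually_elim
    case (elim n)
    then have "0 \<le> c / t n" "c / t n \<le> 1" using \<open>c \<ge> 0\<close> by auto
    then show ?case unfolding y_def using assms(2,3,5) by (intro convexD_alt)
  qed
  have "(\<lambda>n. c / t n) \<longlonglongrightarrow> 0"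
    using t by (intro tendsto_divide_0[OF tendsto_const] filterlim_at_top_imp_at_infinity)
  then have "(\<lambda>n. (1 - c / t n) *\<^sub>R p + c *\<^sub>R (w n /\<^sub>R t n)) \<longlonglongrightarrow> (1 - 0) *\<^sub>R p + c *\<^sub>R z"
    by (intro tendsto_intros lim)
  then show "y \<longlonglongrightarrow> p + c *\<^sub>R z" by (simp add: y_def[abs_def] divide_inverse)
qed simp

text \<open>The recession comes from the points \<open>y n\<close>, but the direction is stated as a
  limit along \<open>x n\<close>, since in the application it is \<open>x n\<close> that lies in the
  cone.\<close>

lemma sublevel_recession_direction:
  fixes f :: "'a::euclidean_space \<Rightarrow> real"
  assumes f: "piecewise_affine f" and y: "\<And>n. y n \<in> sublevel f"
    and x: "filterlim (\<lambda>n. norm (x n)) at_top sequentially"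
    and near: "\<And>n. norm (x n - y n) \<le> C"
  obtains z \<rho> where "z \<in> recession_cone (sublevel f)" "norm z = 1"
    "strict_mono \<rho>" "(\<lambda>n. x (\<rho> n) /\<^sub>R norm (x (\<rho> n))) \<longlonglongrightarrow> z"
proof -
  obtain I :: "nat set" and Q a v where I: "finite I" "\<And>k. k \<in> I \<Longrightarrow> polyhedron (Q k)"
    and cov: "\<And>x. \<exists>k\<in>I. x \<in> Q k"
    and f: "\<And>k x. k \<in> I \<Longrightarrow> x \<in> Q k \<Longrightarrow> f x = a k + v k \<bullet> x"
    using f by (rule piecewise_affine_obtains) blast
  have "\<forall>n. \<exists>k. k \<in> I \<and> y n \<in> Q k" using cov by blast
  then obtain k where k: "\<And>n. k n \<in> I" "\<And>n. y n \<in> Q (k n)" by metis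
  \<comment> \<open>Pigeonhole: one cell contains \<open>y n\<close> for infinitely many
    \<open>n\<close>, and enumerating these indices gives a subsequence.\<close>
  have "finite (range k)" using I(1) k(1) finite_subset[of "range k" I] by auto
  then obtain n0 where inf: "infinite {n. k n = k n0}"
    using pigeonhole_infinite[OF infinite_UNIV_nat] by auto
  define K where "K = k n0"
  define r where "r = enumerate {n. k n = K}"
  have r: "strict_mono r" "\<And>n. k (r n) = K"
    using inf strict_mono_enumerate[of "{n. k n = K}"] enumerate_in_set[of "{n. k n = K}"]
    by (auto simp: r_def K_def)
  \<comment> \<open>The part of the sublevel set inside one cell is a polyhedron, hence closed and
    convex, which the whole sublevel set need not be.\<close>
  define P where "P = Q K \<inter> {x. v K \<bullet> x \<le> - a K}"
  have K: "K \<in> I" using k by (simp add: K_def)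
  have "polyhedron P" unfolding P_def by (intro polyhedron_Int polyhedron_halfspace_le I(2) K)
  then have P: "closed P" "convex P"
    by (simp_all add: polyhedron_imp_closed polyhedron_imp_convex)
  have PS: "P \<subseteq> sublevel f" using f[OF K] by (auto simp: P_def sublevel_def)
  have yP: "y (r n) \<in> P" for n
  proof -
    have "y (r n) \<in> Q K" using k(2)[of "r n"] r(2) by simp
    then show ?thesis using f[OF K] y[of "r n"] by (auto simp: P_def sublevel_def)
  qed
  \<comment> \<open>A vanishing \<open>x (r n)\<close> normalizes to 0, so only the inequality holds
    for every \<open>n\<close>.\<close>
  have "norm (x (r n) /\<^sub>R norm (x (r n))) \<le> 1" for n
    by (cases "x (r n) = 0") auto
  then have "bounded (range (\<lambda>n. x (r n) /\<^sub>R norm (x (r n))))"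
    by (intro boundedI[of _ 1]) blast
  then obtain z r' where r': "strict_mono r'"
    and z: "((\<lambda>n. x (r n) /\<^sub>R norm (x (r n))) \<circ> r') \<longlonglongrightarrow> z"
    using bounded_imp_convergent_subsequence by blast
  define \<rho> where "\<rho> = r \<circ> r'"
  have \<rho>: "strict_mono \<rho>" unfolding \<rho>_def using r(1) r' by (rule strict_mono_o)
  have z: "(\<lambda>n. x (\<rho> n) /\<^sub>R norm (x (\<rho> n))) \<longlonglongrightarrow> z"
    using z by (simp add: \<rho>_def o_def)
  have t: "filterlim (\<lambda>n. norm (x (\<rho> n))) at_top sequentially"
    using filterlim_compose[OF x filterlim_subseq[OF \<rho>]] .
  have "eventually (\<lambda>n. norm (x (\<rho> n) /\<^sub>R norm (x (\<rho> n))) = 1) sequentially"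
    using t[unfolded filterlim_at_top, rule_format, of 1]
  proof eventually_elim
    case (elim n)
    then have "x (\<rho> n) \<noteq> 0" by auto
    then show ?case by simp
  qed
  then have "(\<lambda>n. norm (x (\<rho> n) /\<^sub>R norm (x (\<rho> n)))) \<longlonglongrightarrow> 1"
    by (rule tendsto_eventually)
  then have "norm z = 1" using tendsto_norm[OF z] LIMSEQ_unique by blast
  \<comment> \<open>A difference bounded by \<open>C\<close> disappears after division by the
    diverging norms, so \<open>y\<close> inherits the limit direction of \<open>x\<close>.\<close>
  have "(\<lambda>n. (y (\<rho> n) - x (\<rho> n)) /\<^sub>R norm (x (\<rho> n))) \<longlonglongrightarrow> 0"
  proof (rule Lim_null_comparison)
    show "eventually (\<lambda>n. norm ((y (\<rho> n) - x (\<rho> n)) /\<^sub>R norm (x (\<rho> n))) \<le> C / norm (x (\<rho> n)))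
        sequentially"
      using near
      by (auto simp: divide_inverse norm_minus_commute mult.commute[of _ "norm (_ - _)"]
          intro!: always_eventually mult_right_mono)
    show "(\<lambda>n. C / norm (x (\<rho> n))) \<longlonglongrightarrow> 0"
      using t by (intro tendsto_divide_0[OF tendsto_const] filterlim_at_top_imp_at_infinity)
  qed
  from tendsto_add[OF this z] have lim: "(\<lambda>n. y (\<rho> n) /\<^sub>R norm (x (\<rho> n))) \<longlonglongrightarrow> z"
    by (simp add: algebra_simps)
  have "y (\<rho> n) \<in> P" for n using yP by (simp add: \<rho>_def)
  then have "y (\<rho> 0) + c *\<^sub>R z \<in> P" if "c \<ge> 0" for c
    using closed_convex_recession_limit[OF P _ that _ t lim] by blast
  moreover have "y (\<rho> 0) \<in> sublevel f" by (rule y)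
  ultimately have "z \<in> recession_cone (sublevel f)"
    using PS unfolding recession_cone_def by blast
  then show ?thesis using that \<open>norm z = 1\<close> \<rho> z by blast
qed

lemma error_bound_imp_coercive:
  fixes f :: "'a::euclidean_space \<Rightarrow> real"
  assumes N: "is_norm N" and f: "piecewise_affine f" and ne: "sublevel f \<noteq> {}"
    and V: "cone V" and rc: "recession_cone (sublevel f) \<inter> closure V = {0}"
    and eb: "has_error_bound_on N f V"
  shows "coercive_on N f V"
  unfolding coercive_on_def
proof (intro allI impI, rule ccontr)
  fix x :: "nat \<Rightarrow> 'a"
  assume xV: "\<forall>n. x n \<in> V" and xN: "filterlim (\<lambda>n. N (x n)) at_top sequentially"
    and nf: "\<not> filterlim (\<lambda>n. f (x n)) at_top sequentially"
  obtain b B where bB: "b > 0" "B > 0" "\<And>x. b * norm x \<le> N x" "\<And>x. N x \<le> B * norm x"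
    by (rule is_norm_equivalent[OF N]) blast
  obtain \<tau> where \<tau>: "\<tau> > 0" "\<And>x. x \<in> V \<Longrightarrow> \<tau> * norm_dist N x (sublevel f) \<le> max (f x) 0"
    using eb unfolding has_error_bound_on_def by blast
  obtain Z where "\<not> eventually (\<lambda>n. Z \<le> f (x n)) sequentially"
    using nf by (auto simp: filterlim_at_top)
  then obtain r :: "nat \<Rightarrow> nat" where r: "strict_mono r" "\<And>n. \<not> Z \<le> f (x (r n))"
    using not_eventually_sequentiallyD[of "\<lambda>n. Z \<le> f (x n)"] by blast
  \<comment> \<open>The summand 1 makes the distance strictly less than \<open>C\<close>, so some
    point of the sublevel set is nearer than \<open>C\<close> even if the infimum is not known to be
    attained.\<close>
  define C where "C = (max Z 0 + 1) / \<tau>"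
  have "\<exists>y\<in>sublevel f. N (x (r n) - y) < C" for n
  proof -
    have "\<tau> * norm_dist N (x (r n)) (sublevel f) < max Z 0 + 1"
      using \<tau>(2)[of "x (r n)"] xV r(2)[of n] by (auto simp: max_def split: if_splits)
    then have "norm_dist N (x (r n)) (sublevel f) < C"
      using \<tau>(1) by (simp add: C_def field_simps)
    then show ?thesis using norm_dist_less_obtains[OF N ne] by blast
  qed
  then obtain y where y: "\<And>n. y n \<in> sublevel f" "\<And>n. N (x (r n) - y n) < C" by metis
  have near: "norm (x (r n) - y n) \<le> C / b" for n
    using y(2)[of n] bB(3)[of "x (r n) - y n"] bB(1) by (simp add: field_simps)
  have "filterlim (\<lambda>n. N (x (r n))) at_top sequentially"
    using filterlim_compose[OF xN filterlim_subseq[OF r(1)]] .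
  then have "filterlim (\<lambda>n. B * norm (x (r n))) at_top sequentially"
    by (rule filterlim_at_top_mono) (use bB(4) in auto)
  then have "filterlim (\<lambda>n. norm (x (r n))) at_top sequentially"
    using bB(2) by (subst (asm) filterlim_tendsto_pos_mult_at_top_iff[OF tendsto_const]) auto
  then obtain z \<rho> where z: "z \<in> recession_cone (sublevel f)" "norm z = 1"
    and lim: "(\<lambda>n. x (r (\<rho> n)) /\<^sub>R norm (x (r (\<rho> n)))) \<longlonglongrightarrow> z"
    by (rule sublevel_recession_direction[OF f y(1) _ near])
  \<comment> \<open>The cone is closed under nonnegative scaling, which includes the factor
    \<open>inverse 0 = 0\<close>.\<close>
  have "x (r (\<rho> n)) /\<^sub>R norm (x (r (\<rho> n))) \<in> V" for n
    using V xV by (simp add: cone_def)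
  then have "z \<in> closure V"
    using lim unfolding closure_sequential by (intro exI conjI allI)
  then have "z = 0" using rc z(1) by blast
  then show False using z(2) by simp
qed

theorem theorem7:
  fixes N :: "real ^ 'd \<Rightarrow> real"
    and f :: "real ^ 'd \<Rightarrow> real"
    and V :: "(real ^ 'd) set"
  assumes "is_norm N"
    and "piecewise_affine f"
    and "sublevel f \<noteq> {}"
    and "V \<noteq> {}" and "cone V"
  shows "(coercive_on N f V \<longrightarrow> has_error_bound_on N f V) \<and>
         (recession_cone (sublevel f) \<inter> closure V = {0} \<longrightarrow>
            has_error_bound_on N f V \<longrightarrow> coercive_on N f V)"
  using coercive_imp_error_bound[OF assms(1-3,5)] error_bound_imp_coercive[OF assms(1-3,5)]
  by simp

end
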